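(* The map $H\mapsto \operatorname{lgcd}(H)$ is a bijection from the set of nontrivial subgroups of $(\mathbb{Q},+)$ onto the set $\mathrm{Seq}_{\le 0}(\overline{\mathbb{Z}})$ of eventually nonpositive sequences in $\overline{\mathbb{Z}}=\mathbb{Z}\cup\{-\infty\}$ indexed by the primes. Its inverse is $\mathbf{s}\mapsto H_{\mathbf{s}}$, where $$H_{\mathbf{s}}=\pm\{\mathbb{P}^{\mathbf{e}} : \mathbf{e}\in \mathrm{Seq}_0(\mathbb{Z}),\ \mathbf{s}\preceq\mathbf{e}\}\cup\{0\}.$$ Moreover, this map is an anti-isomorphism of lattices; that is, for all nontrivial subgroups $H,K$ of $(\mathbb{Q},+)$, $$H\leqslant K \iff \operatorname{lgcd}(H)\succeq\operatorname{lgcd}(K).$$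
   Context: $\mathbb{P}$ is the set of prime numbers and $\overline{\mathbb{Z}}=\mathbb{Z}\cup\{-\infty\}$ with $-\infty<z$ for all $z\in\mathbb{Z}$. Sequences are maps $\mathbf{s}\colon\mathbb{P}\to\overline{\mathbb{Z}}$, ordered coordinatewise: $\mathbf{s}\preceq\mathbf{r}$ iff $\mathbf{s}(p)\le\mathbf{r}(p)$ for all $p\in\mathbb{P}$. $\mathrm{Seq}_0(\mathbb{Z})$ is the set of sequences $\mathbb{P}\to\mathbb{Z}$ with finitely many nonzero entries. $\mathrm{Seq}_{\le 0}(\overline{\mathbb{Z}})$ is the set of sequences $\mathbb{P}\to\overline{\mathbb{Z}}$ with only finitely many strictly positive entries. For $\mathbf{e}\in\mathrm{Seq}_0(\mathbb{Z})$, $\mathbb{P}^{\mathbf{e}}=\prod_{p\in\mathbb{P}}p^{\mathbf{e}(p)}\in\mathbb{Q}^+$ (positive rationals). For $r\in\mathbb{Q}^+$, $\operatorname{plog}(r)=(\operatorname{plog}_p(r))_{p\in\mathbb{P}}\in\mathrm{Seq}_0(\mathbb{Z})$ is the sequence of $p$-adic valuations of $r$, so $r=\mathbb{P}^{\operatorname{plog}(r)}$. For a subset $R\subseteq\mathbb{Q}$ containing a nonzero element, $\operatorname{lgcd}(R)$ is the coordinatewise infimum (in $\overline{\mathbb{Z}}$) of $\{\operatorname{plog}(|r|): r\in R\setminus\{0\}\}$. *)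

theory Defs
  imports
    "HOL-Computational_Algebra.Computational_Algebra"
    "HOL-Algebra.Elementary_Groups"
    "HOL-Library.Lattice_Constructions"
begin

typedef prime_number = "{p::nat. prime p}"
  morphisms nat_of_prime prime_of_nat
  using two_is_prime_nat by blast

text \<open>
  In the type \<open>int bot\<close>, \<open>Bot\<close> plays the role of minus infinity. Sequences indexed by the primes
  are functions on \<open>prime_number\<close>, and their coordinatewise order is the library order on
  functions. The constructor is written \<open>bot.Value\<close> because other types of the
  imported theory also have a constructor \<open>Value\<close>.
\<close>

type_synonym zbar = "int bot"

definition Seq_0 :: "(prime_number \<Rightarrow> int) set" where
  "Seq_0 = {e. finite {p. e p \<noteq> 0}}"

definition Seq_le_0 :: "(prime_number \<Rightarrow> zbar) set" where
  "Seq_le_0 = {s. finite {p. bot.Value 0 < s p}}"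

definition embed_seq :: "(prime_number \<Rightarrow> int) \<Rightarrow> prime_number \<Rightarrow> zbar" where
  "embed_seq e = (\<lambda>p. bot.Value (e p))"

definition prime_power_prod :: "(prime_number \<Rightarrow> int) \<Rightarrow> rat" where
  "prime_power_prod e = (\<Prod>p | e p \<noteq> 0. of_nat (nat_of_prime p) powi e p)"

text \<open>
  \<open>quotient_of r\<close> is the reduced fraction of \<open>r\<close>, so the difference below is the valuation of \<open>r\<close>
  for \<open>r \<noteq> 0\<close>; the value at \<open>0\<close> is never used.
\<close>

definition plog :: "rat \<Rightarrow> prime_number \<Rightarrow> int" where
  "plog r p =
     int (multiplicity (int (nat_of_prime p)) (fst (quotient_of r))) -
     int (multiplicity (int (nat_of_prime p)) (snd (quotient_of r)))"

text \<open>
  The infimum is taken in \<open>zbar\<close>, as a greatest lower bound: it is an integer if the set is bounded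
  below in \<open>int\<close>, and \<open>Bot\<close> otherwise. It exists as soon as \<open>R\<close> contains a nonzero element.
\<close>

definition lgcd :: "rat set \<Rightarrow> prime_number \<Rightarrow> zbar" where
  "lgcd R = (\<lambda>p. GREATEST z. \<forall>r\<in>R - {0}. z \<le> bot.Value (plog \<bar>r\<bar> p))"

definition rational_group :: "rat monoid" where
  "rational_group = \<lparr>carrier = UNIV, monoid.mult = (+), one = 0\<rparr>"

lemma group_rational_group: "group rational_group"
  unfolding rational_group_def
proof (rule groupI; simp add: add.assoc)
  show "\<And>x::rat. \<exists>y. y + x = 0"
    by (metis add.left_inverse)
qed

definition nontrivial_subgroups :: "rat set set" where
  "nontrivial_subgroups = {H. subgroup H rational_group \<and> H \<noteq> {0}}"

definition subgroup_of_seq :: "(prime_number \<Rightarrow> zbar) \<Rightarrow> rat set" where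
  "subgroup_of_seq s =
     {prime_power_prod e | e. e \<in> Seq_0 \<and> s \<le> embed_seq e} \<union>
     {- prime_power_prod e | e. e \<in> Seq_0 \<and> s \<le> embed_seq e} \<union> {0}"

definition subgroup_lattice :: "rat set gorder" where
  "subgroup_lattice = \<lparr>carrier = nontrivial_subgroups, eq = (=), le = (\<subseteq>)\<rparr>"

definition seq_lattice :: "(prime_number \<Rightarrow> zbar) gorder" where
  "seq_lattice = \<lparr>carrier = Seq_le_0, eq = (=), le = (\<le>)\<rparr>"

end

theory Submission
  imports Defs
begin

section \<open>Valuations of rational numbers\<close>

text \<open>By unique factorization a nonzero rational is, up to sign, the same thing as its
  finitely supported sequence of valuations (\<open>plog_prime_power_prod\<close>,
  \<open>prime_power_prod_plog\<close>). Hence \<open>subgroup_of_seq s\<close> consists of 0 and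
  the rationals whose valuations dominate \<open>s\<close> (\<open>subgroup_of_seq_eq\<close>). It
  is a group by the ultrametric inequality, and its infimum is \<open>s\<close> because valuations
  can be prescribed independently at each prime (\<open>lgcd_subgroup_of_seq\<close>).

  The substantial point is that a subgroup H contains every nonzero x allowed by its infimum
  (\<open>mem_if_lgcd_le_plog\<close>), even when no single element attains that infimum at all
  primes. The argument is local-to-global: the integers n with n x in H form an ideal, each prime p
  fails to divide some element of it, and an ideal lying in no pZ contains 1
  (\<open>one_mem_int_ideal\<close>).

  So \<open>lgcd\<close> and \<open>subgroup_of_seq\<close> are mutually inverse. Both reverse the
  order, which gives the equivalence and carries coordinatewise min and max over to
  subgroups.\<close>

lemma prime_nat_of_prime [simp]: "prime (nat_of_prime p)"
  using nat_of_prime by simp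

lemma prime_elem_int_prime [simp]: "prime_elem (int (nat_of_prime p))"
  using prime_nat_of_prime[of p] by (intro prime_imp_prime_elem) simp

lemma nat_of_prime_pos [simp]: "nat_of_prime p > 0"
  using prime_nat_of_prime prime_gt_0_nat by blast

lemma quotient_of_nonzero:
  assumes "x \<noteq> 0"
  obtains a b where "quotient_of x = (a, b)" "x = of_int a / of_int b" "a \<noteq> 0" "b > 0" "coprime a b"
proof -
  obtain a b where "quotient_of x = (a, b)" by force
  with assms that show thesis
    using quotient_of_div quotient_of_denom_pos quotient_of_coprime by fastforce
qed

text \<open>Cross-multiplying with the reduced fraction shows that the valuation may be read off any
  fraction. This removes \<open>quotient_of\<close> from the computations with sums and
  products.\<close>

lemma plog_divide:
  assumes "a \<noteq> 0" "b \<noteq> 0"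
  shows "plog (of_int a / of_int b) p =
    int (multiplicity (int (nat_of_prime p)) a) - int (multiplicity (int (nat_of_prime p)) b)"
proof -
  have "of_int a / of_int b \<noteq> (0::rat)" using assms by simp
  then obtain c d where q: "quotient_of (of_int a / of_int b) = (c, d)"
    and e: "of_int a / of_int b = (of_int c / of_int d :: rat)" and nz: "c \<noteq> 0" "d > 0"
    by (rule quotient_of_nonzero) blast
  have "(of_int (a * d) :: rat) = of_int (c * b)"
    using e assms nz by (simp add: field_simps)
  then have "a * d = c * b" by (simp only: of_int_eq_iff)
  then have "multiplicity (int (nat_of_prime p)) (a * d) = multiplicity (int (nat_of_prime p)) (c * b)"
    by simp
  then show ?thesis
    using assms nz by (simp add: plog_def q prime_elem_multiplicity_mult_distrib)
qed

lemma plog_mult: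
  assumes "x \<noteq> 0" "y \<noteq> 0"
  shows "plog (x * y) p = plog x p + plog y p"
proof -
  obtain a b where x: "x = of_int a / of_int b" "a \<noteq> 0" "b > 0"
    using assms(1) by (rule quotient_of_nonzero)
  obtain c d where y: "y = of_int c / of_int d" "c \<noteq> 0" "d > 0"
    using assms(2) by (rule quotient_of_nonzero)
  have "x * y = of_int (a * c) / of_int (b * d)" using x y by simp
  then have "plog (x * y) p = plog (of_int (a * c) / of_int (b * d)) p" by simp
  also have "\<dots> = plog x p + plog y p"
    using x y by (simp add: plog_divide prime_elem_multiplicity_mult_distrib del: of_int_mult)
  finally show ?thesis .
qed

lemma plog_one [simp]: "plog 1 p = 0"
  by (simp add: plog_def)

lemma plog_minus [simp]: "plog (- x) p = plog x p"
proof (cases "x = 0")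
  case False
  then obtain a b where x: "x = of_int a / of_int b" "a \<noteq> 0" "b > 0"
    by (rule quotient_of_nonzero)
  then have "- x = of_int (- a) / of_int b" by simp
  then have "plog (- x) p = plog (of_int (- a) / of_int b) p" by simp
  then show ?thesis
    using x by (simp add: plog_divide del: of_int_minus)
qed simp

lemma plog_abs [simp]: "plog \<bar>x\<bar> p = plog x p"
  by (simp add: abs_if)

text \<open>The ultrametric inequality: over a common denominator it reduces to divisibility of a
  sum of integers.\<close>

lemma plog_add:
  assumes "x \<noteq> 0" "y \<noteq> 0" "x + y \<noteq> 0"
  shows "min (plog x p) (plog y p) \<le> plog (x + y) p"
proof -
  let ?m = "multiplicity (int (nat_of_prime p))"
  obtain a b where x: "x = of_int a / of_int b" "a \<noteq> 0" "b > 0"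
    using assms(1) by (rule quotient_of_nonzero)
  obtain c d where y: "y = of_int c / of_int d" "c \<noteq> 0" "d > 0"
    using assms(2) by (rule quotient_of_nonzero)
  have eq: "x + y = of_int (a * d + c * b) / of_int (b * d)"
    using x y by (simp add: field_simps)
  then have nz: "a * d + c * b \<noteq> 0" using assms(3) by (metis div_0 of_int_0)
  \<comment> \<open>The smaller of the two powers of p divides both summands.\<close>
  have "int (nat_of_prime p) ^ min (?m (a * d)) (?m (c * b)) dvd a * d + c * b"
    by (intro dvd_add multiplicity_dvd') simp_all
  then have "min (?m (a * d)) (?m (c * b)) \<le> ?m (a * d + c * b)"
    using nz prime_elem_not_unit[OF prime_elem_int_prime]
    by (subst (asm) power_dvd_iff_le_multiplicity) auto
  moreover have "plog (x + y) p = int (?m (a * d + c * b)) - int (?m (b * d))"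
    using eq nz x y plog_divide[of "a * d + c * b" "b * d" p] by simp
  ultimately show ?thesis
    using x y by (simp add: plog_divide prime_elem_multiplicity_mult_distrib)
qed

lemma plog_inverse:
  assumes "x \<noteq> 0"
  shows "plog (inverse x) p = - plog x p"
  using plog_mult[of x "inverse x" p] assms by simp

lemma plog_power: "x \<noteq> 0 \<Longrightarrow> plog (x ^ n) p = int n * plog x p"
  by (induction n) (simp_all add: plog_mult algebra_simps)

lemma plog_power_int: "x \<noteq> 0 \<Longrightarrow> plog (x powi k) p = k * plog x p"
  by (simp add: power_int_def plog_power plog_inverse)

lemma plog_prod:
  assumes "finite A" "\<And>i. i \<in> A \<Longrightarrow> f i \<noteq> 0"
  shows "plog (\<Prod>i\<in>A. f i) p = (\<Sum>i\<in>A. plog (f i) p)"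
  using assms by (induction A rule: finite_induct) (simp_all add: plog_mult)

lemma plog_prime: "plog (of_nat (nat_of_prime q)) p = of_bool (p = q)"
proof -
  have "multiplicity (int (nat_of_prime p)) (int (nat_of_prime q)) = of_bool (p = q)"
    by (auto simp: nat_of_prime_inject intro!: prime_multiplicity_other)
  then show ?thesis by (simp add: plog_def)
qed

section \<open>Unique factorization of rationals\<close>

lemma plog_prime_power_prod:
  assumes "e \<in> Seq_0"
  shows "plog (prime_power_prod e) = e"
proof
  fix p
  have fin: "finite {q. e q \<noteq> 0}" using assms by (simp add: Seq_0_def)
  have "plog (prime_power_prod e) p = (\<Sum>q | e q \<noteq> 0. e q * of_bool (p = q))"
    unfolding prime_power_prod_def using fin
    by (simp add: plog_prod plog_power_int plog_prime)
  also have "\<dots> = (\<Sum>q | e q \<noteq> 0. if p = q then e q else 0)"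
    by (intro sum.cong) auto
  also have "\<dots> = e p" using fin by simp
  finally show "plog (prime_power_prod e) p = e p" .
qed

lemma prime_power_prod_pos: "prime_power_prod e > 0"
  unfolding prime_power_prod_def by (intro prod_pos zero_less_power_int) simp

text \<open>A prime with nonzero valuation divides the numerator or the denominator, and a nonzero
  integer has only finitely many divisors.\<close>

lemma plog_in_Seq_0: "plog x \<in> Seq_0"
proof (cases "x = 0")
  case True
  then show ?thesis by (simp add: Seq_0_def plog_def)
next
  case False
  then obtain a b where x: "quotient_of x = (a, b)" "a \<noteq> 0" "b > 0"
    by (rule quotient_of_nonzero)
  have "finite {d. d dvd a * b}" using x by simp
  moreover have "(\<lambda>p. int (nat_of_prime p)) ` {p. plog x p \<noteq> 0} \<subseteq> {d. d dvd a * b}"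
  proof clarsimp
    fix p assume "plog x p \<noteq> 0"
    moreover have "plog x p = 0" if "\<not> int (nat_of_prime p) dvd a" "\<not> int (nat_of_prime p) dvd b"
      using that by (simp add: plog_def x(1) not_dvd_imp_multiplicity_0)
    ultimately have "int (nat_of_prime p) dvd a \<or> int (nat_of_prime p) dvd b"
      by blast
    then show "int (nat_of_prime p) dvd a * b" by auto
  qed
  moreover have "inj (\<lambda>p. int (nat_of_prime p))"
    by (simp add: inj_def nat_of_prime_inject)
  ultimately show ?thesis
    unfolding Seq_0_def mem_Collect_eq
    by (meson finite_subset finite_imageD inj_on_subset subset_UNIV)
qed

text \<open>In lowest terms a prime dividing the numerator misses the denominator, so the valuation
  there would be positive.\<close>

lemma plog_nonpos_imp_not_dvd:
  assumes "quotient_of x = (a, b)" "a \<noteq> 0" "plog x p \<le> 0"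
  shows "\<not> int (nat_of_prime p) dvd a"
proof
  assume dvd: "int (nat_of_prime p) dvd a"
  then have "multiplicity (int (nat_of_prime p)) a > 0"
    using assms(2) by (subst prime_multiplicity_gt_zero_iff) auto
  with assms have "multiplicity (int (nat_of_prime p)) b \<noteq> 0"
    by (auto simp: plog_def)
  then have "int (nat_of_prime p) dvd b"
    by (metis not_dvd_imp_multiplicity_0)
  with dvd show False
    using quotient_of_coprime[OF assms(1)] prime_elem_int_prime[of p]
    by (meson coprime_common_divisor prime_elem_not_unit)
qed

lemma int_unit_if_no_prime_dvd:
  fixes a :: int
  assumes "\<And>p. \<not> int (nat_of_prime p) dvd a"
  shows "\<bar>a\<bar> = 1"
proof (rule ccontr)
  assume "\<bar>a\<bar> \<noteq> 1"
  then have "nat \<bar>a\<bar> \<noteq> 1" by linarith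
  then obtain q where "prime q" "q dvd nat \<bar>a\<bar>" using prime_factor_nat by blast
  then have "int (nat_of_prime (prime_of_nat q)) dvd a"
    by (simp add: prime_of_nat_inverse dvd_nat_abs_iff)
  with assms show False by blast
qed

text \<open>The uniqueness half of factorization: no prime divides the numerator, so it is a unit
  and x is at most 1; the inverse of x satisfies the same hypotheses.\<close>

lemma plog_eq_0_imp_eq_1:
  assumes "x > 0" "\<And>p. plog x p = 0"
  shows "x = 1"
proof -
  have num: "\<bar>fst (quotient_of y)\<bar> = 1" if "y > 0" "\<And>p. plog y p = 0" for y
  proof -
    from that have "y \<noteq> 0" by simp
    then obtain a b where "quotient_of y = (a, b)" "a \<noteq> 0" by (rule quotient_of_nonzero)
    then show ?thesis
      using int_unit_if_no_prime_dvd plog_nonpos_imp_not_dvd that(2)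
      by (metis fst_conv order_refl)
  qed
  have *: "x \<le> 1" if "x > 0" "\<And>p. plog x p = 0" for x
  proof -
    from that have "x \<noteq> 0" by simp
    then obtain a b where "quotient_of x = (a, b)" "x = of_int a / of_int b" "b > 0"
      by (rule quotient_of_nonzero)
    with num[OF that] have "a \<le> b" by simp
    with \<open>x = _\<close> \<open>b > 0\<close> show ?thesis by simp
  qed
  have "inverse x \<le> 1" using assms by (intro *) (simp_all add: plog_inverse)
  with *[OF assms] assms(1) show ?thesis by (simp add: field_simps)
qed

text \<open>The quotient of the two sides is positive with all valuations 0, hence equals 1.\<close>

lemma prime_power_prod_plog:
  assumes "x \<noteq> 0"
  shows "prime_power_prod (plog x) = \<bar>x\<bar>"
proof -
  let ?y = "prime_power_prod (plog x)"
  have y: "?y > 0" by (rule prime_power_prod_pos)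
  have "\<bar>x\<bar> * inverse ?y = 1"
    using assms y
    by (intro plog_eq_0_imp_eq_1)
      (simp_all add: plog_mult plog_inverse plog_prime_power_prod plog_in_Seq_0)
  with y show ?thesis by (simp add: field_simps)
qed

text \<open>Replaces the description by signed prime power products with a condition on valuations,
  the form in which membership is tested from here on.\<close>

lemma subgroup_of_seq_eq:
  "subgroup_of_seq s = {x. x = 0 \<or> (\<forall>p. s p \<le> bot.Value (plog x p))}"
proof (rule Set.set_eqI, rule iffI)
  fix x assume "x \<in> subgroup_of_seq s"
  then show "x \<in> {x. x = 0 \<or> (\<forall>p. s p \<le> bot.Value (plog x p))}"
    by (auto simp: subgroup_of_seq_def le_fun_def embed_seq_def plog_prime_power_prod)
next
  fix x assume x: "x \<in> {x. x = 0 \<or> (\<forall>p. s p \<le> bot.Value (plog x p))}"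
  show "x \<in> subgroup_of_seq s"
  proof (cases "x = 0")
    case False
    then have "x = prime_power_prod (plog x) \<or> x = - prime_power_prod (plog x)"
      by (simp add: prime_power_prod_plog abs_if)
    then show ?thesis
      using x False plog_in_Seq_0[of x]
      unfolding subgroup_of_seq_def le_fun_def embed_seq_def by blast
  qed (simp add: subgroup_of_seq_def)
qed

section \<open>Subgroups of the rational numbers\<close>

lemma inv_rational_group [simp]: "inv\<^bsub>rational_group\<^esub> x = - x"
proof -
  interpret group rational_group by (rule group_rational_group)
  show ?thesis by (intro inv_equality) (simp_all add: rational_group_def)
qed

lemma subgroup_rational_group_iff:
  "subgroup H rational_group \<longleftrightarrow>
    0 \<in> H \<and> (\<forall>x\<in>H. - x \<in> H) \<and> (\<forall>x\<in>H. \<forall>y\<in>H. x + y \<in> H)"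
  unfolding subgroup_def inv_rational_group by (auto simp: rational_group_def)

lemma of_int_mult_closed:
  assumes "subgroup H rational_group" "x \<in> H"
  shows "of_int k * x \<in> H"
proof -
  have nat: "of_nat n * x \<in> H" for n
    using assms by (induction n) (auto simp: subgroup_rational_group_iff algebra_simps)
  show ?thesis
    using nat assms(1) by (cases k rule: int_cases2) (auto simp: subgroup_rational_group_iff)
qed

lemma nontrivial_subgroupD:
  assumes "H \<in> nontrivial_subgroups"
  shows "subgroup H rational_group" "\<exists>r\<in>H. r \<noteq> 0"
  using assms by (auto simp: nontrivial_subgroups_def subgroup_rational_group_iff)

section \<open>The infimum of a subgroup\<close>

text \<open>Shows that the \<open>GREATEST\<close> in the definition of \<open>lgcd\<close> really
  exists, and turns it into the universal property of an infimum. A nonzero r in H caps the lower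
  bounds, so either an integer is the greatest of them or only \<open>Bot\<close> is one.\<close>

lemma lgcd_characterization:
  assumes "H \<in> nontrivial_subgroups"
  shows "z \<le> lgcd H p \<longleftrightarrow> (\<forall>r\<in>H - {0}. z \<le> bot.Value (plog r p))"
proof -
  obtain r where r: "r \<in> H" "r \<noteq> 0" using nontrivial_subgroupD(2)[OF assms] by blast
  let ?P = "\<lambda>z. \<forall>r\<in>H - {0}. z \<le> bot.Value (plog \<bar>r\<bar> p)"
  have "\<exists>g. ?P g \<and> (\<forall>z. ?P z \<longrightarrow> z \<le> g)"
  proof (cases "\<exists>k. ?P (bot.Value k)")
    case True
    then obtain k where k: "?P (bot.Value k)" by blast
    have bound: "j \<le> plog r p" if "?P (bot.Value j)" for j using that r by auto
    \<comment> \<open>Lower bounds are measured as offsets above the known bound k: these are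
      naturals and cannot exceed \<open>plog r p - k\<close>.\<close>
    let ?n = "GREATEST n. ?P (bot.Value (k + int n))"
    have n: "?P (bot.Value (k + int ?n))"
    proof (rule GreatestI_nat[where k = 0 and b = "nat (plog r p - k)"])
      show "m \<le> nat (plog r p - k)" if "?P (bot.Value (k + int m))" for m
        using bound[OF that] by linarith
    qed (use k in simp)
    have "z \<le> bot.Value (k + int ?n)" if z: "?P z" for z
    proof (cases z)
      case (Value j)
      show ?thesis
      proof (cases "j \<le> k")
        case False
        then have "nat (j - k) \<le> ?n"
        proof (intro Greatest_le_nat[where b = "nat (plog r p - k)"])
          show "m \<le> nat (plog r p - k)" if "?P (bot.Value (k + int m))" for m
            using bound[OF that] by linarith
        qed (use z Value False in simp)
        with Value False show ?thesis by simp
      qed (use Value in simp)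
    qed simp
    with n show ?thesis by blast
  next
    case False
    have "z \<le> bot.Bot" if "?P z" for z using False that by (cases z) auto
    then show ?thesis by (intro exI[of _ bot.Bot]) simp
  qed
  then obtain g where g: "?P g" "\<And>z. ?P z \<Longrightarrow> z \<le> g" by blast
  then have "lgcd H p = g" unfolding lgcd_def by (intro Greatest_equality) auto
  with g show ?thesis by (auto intro: order_trans)
qed

lemma lgcd_le_plog:
  "H \<in> nontrivial_subgroups \<Longrightarrow> r \<in> H \<Longrightarrow> r \<noteq> 0 \<Longrightarrow> lgcd H p \<le> bot.Value (plog r p)"
  using lgcd_characterization by blast

text \<open>One nonzero element bounds the infimum from above, and its valuations vanish at almost
  all primes.\<close>

lemma lgcd_in_Seq_le_0:
  assumes "H \<in> nontrivial_subgroups"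
  shows "lgcd H \<in> Seq_le_0"
proof -
  obtain r where r: "r \<in> H" "r \<noteq> 0" using nontrivial_subgroupD(2)[OF assms] by blast
  have "{p. bot.Value 0 < lgcd H p} \<subseteq> {p. plog r p \<noteq> 0}"
  proof clarify
    fix p assume "bot.Value 0 < lgcd H p" "plog r p = 0"
    with lgcd_le_plog[OF assms r, of p] show False by simp
  qed
  then show ?thesis
    using plog_in_Seq_0[of r] by (simp add: Seq_0_def Seq_le_0_def finite_subset)
qed

lemma lgcd_antimono:
  "H \<in> nontrivial_subgroups \<Longrightarrow> K \<in> nontrivial_subgroups \<Longrightarrow> H \<subseteq> K \<Longrightarrow> lgcd K \<le> lgcd H"
  unfolding le_fun_def by (subst lgcd_characterization) (auto intro: lgcd_le_plog)

section \<open>From sequences to subgroups and back\<close>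

lemma subgroup_of_seq_antimono: "s \<le> t \<Longrightarrow> subgroup_of_seq t \<subseteq> subgroup_of_seq s"
  by (auto simp: subgroup_of_seq_eq le_fun_def intro: order_trans)

lemma subgroup_of_seq_nontrivial:
  assumes "s \<in> Seq_le_0"
  shows "subgroup_of_seq s \<in> nontrivial_subgroups"
proof -
  have "s p \<le> bot.Value (plog (x + y) p)"
    if "s p \<le> bot.Value (plog x p)" "s p \<le> bot.Value (plog y p)" "x \<noteq> 0" "y \<noteq> 0" "x + y \<noteq> 0"
    for x y p
    using plog_add[OF that(3-5), of p] that(1,2) by (cases "s p") auto
  then have sub: "subgroup (subgroup_of_seq s) rational_group"
    unfolding subgroup_rational_group_iff subgroup_of_seq_eq by fastforce
  \<comment> \<open>The positive part of s, with \<open>Bot\<close> sent to 0. It dominates s and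
    has finite support exactly because s is eventually nonpositive, so it yields a nonzero
    element.\<close>
  define e where "e p = (case s p of bot.Value k \<Rightarrow> max 0 k | bot.Bot \<Rightarrow> 0)" for p
  have "bot.Value 0 < s p" if "e p \<noteq> 0" for p
    using that by (cases "s p") (auto simp: e_def max_def split: if_splits)
  then have "{p. e p \<noteq> 0} \<subseteq> {p. bot.Value 0 < s p}" by blast
  then have "e \<in> Seq_0"
    using assms by (simp add: Seq_0_def Seq_le_0_def finite_subset)
  moreover have "s p \<le> bot.Value (e p)" for p
    by (auto simp: e_def split: bot.splits)
  ultimately have "prime_power_prod e \<in> subgroup_of_seq s"
    by (simp add: subgroup_of_seq_eq plog_prime_power_prod)
  then show ?thesis
    using sub prime_power_prod_pos[of e] unfolding nontrivial_subgroups_def by force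
qed

lemma lgcd_subgroup_of_seq:
  assumes s: "s \<in> Seq_le_0"
  shows "lgcd (subgroup_of_seq s) = s"
proof (rule antisym)
  note H = subgroup_of_seq_nontrivial[OF s]
  show "s \<le> lgcd (subgroup_of_seq s)"
    unfolding le_fun_def lgcd_characterization[OF H] by (auto simp: subgroup_of_seq_eq)
  obtain x where x: "x \<in> subgroup_of_seq s" "x \<noteq> 0" using nontrivial_subgroupD(2)[OF H] by blast
  show "lgcd (subgroup_of_seq s) \<le> s"
  proof (rule le_funI)
    fix p
    have bound: "lgcd (subgroup_of_seq s) p \<le> bot.Value k" if "s p \<le> bot.Value k" for k
    proof -
      \<comment> \<open>Altering a nonzero element at the single prime p keeps it in the subgroup
        while its valuation at p takes any integer value k allowed by s.\<close>
      let ?e = "(plog x)(p := k)"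
      have "{q. ?e q \<noteq> 0} \<subseteq> insert p {q. plog x q \<noteq> 0}" by auto
      then have e: "?e \<in> Seq_0"
        using plog_in_Seq_0[of x] finite_subset unfolding Seq_0_def mem_Collect_eq
        by (metis (no_types) finite_insert)
      then have "prime_power_prod ?e \<in> subgroup_of_seq s"
        using x that by (auto simp: subgroup_of_seq_eq plog_prime_power_prod)
      then show ?thesis
        using lgcd_le_plog[OF H, of "prime_power_prod ?e" p] prime_power_prod_pos[of ?e] e
        by (simp add: plog_prime_power_prod)
    qed
    show "lgcd (subgroup_of_seq s) p \<le> s p"
    proof (cases "s p")
      case Bot
      then have "lgcd (subgroup_of_seq s) p \<le> bot.Value k" for k by (intro bound) simp
      \<comment> \<open>An integer value is impossible, since every smaller integer is also an upper
        bound for it.\<close>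
      then have "\<forall>k. lgcd (subgroup_of_seq s) p \<noteq> bot.Value k"
        by (metis bot.inject less_eq_bot_Value not_less lt_ex)
      then have "lgcd (subgroup_of_seq s) p = bot.Bot" by (cases "lgcd (subgroup_of_seq s) p") auto
      then show ?thesis by simp
    qed (use bound in simp)
  qed
qed

section \<open>Recovering a subgroup from its infimum\<close>

text \<open>The least positive element d divides all of I. A prime factor of d would then divide all
  of I as well, so d is 1.\<close>

lemma one_mem_int_ideal:
  fixes I :: "int set"
  assumes add: "\<And>m n. m \<in> I \<Longrightarrow> n \<in> I \<Longrightarrow> m + n \<in> I"
    and mult: "\<And>k n. n \<in> I \<Longrightarrow> k * n \<in> I"
    and prime: "\<And>p. \<exists>n\<in>I. \<not> int (nat_of_prime p) dvd n"
  shows "1 \<in> I"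
proof -
  obtain n0 where n0: "n0 \<in> I" "n0 \<noteq> 0" using prime by (metis dvd_0_right)
  have ex: "\<exists>n. n > 0 \<and> int n \<in> I"
    using n0 mult[OF n0(1), of "sgn n0"]
    by (intro exI[of _ "nat \<bar>n0\<bar>"]) (simp add: abs_sgn[symmetric] mult.commute[of "sgn n0"])
  define d where "d = (LEAST n. n > 0 \<and> int n \<in> I)"
  have d: "d > 0" "int d \<in> I" using LeastI_ex[OF ex] unfolding d_def by auto
  have least: "d \<le> n" if "n > 0" "int n \<in> I" for n
    unfolding d_def using that by (intro Least_le) simp
  have dvd: "int d dvd n" if "n \<in> I" for n
  proof -
    \<comment> \<open>The remainder is a combination of n and d, so it lies in I; minimality of d
      forces it to be 0.\<close>
    have "n mod int d = n + (- (n div int d)) * int d"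
      by (simp add: minus_div_mult_eq_mod)
    then have "n mod int d \<in> I" using add[OF that mult[OF d(2)]] by metis
    moreover have "0 \<le> n mod int d" "n mod int d < int d" using d by auto
    ultimately have "n mod int d = 0"
      using least[of "nat (n mod int d)"] by force
    then show ?thesis by auto
  qed
  have "\<bar>int d\<bar> = 1"
    using prime dvd by (intro int_unit_if_no_prime_dvd) (meson dvd_trans)
  with d(2) show ?thesis by simp
qed

text \<open>
  The integers \<open>n\<close> with \<open>n x \<in> H\<close> form an ideal. For every prime \<open>p\<close> some \<open>h \<in> H\<close> has valuation at
  most that of \<open>x\<close>, and the numerator of \<open>h / x\<close> is an element of the ideal prime to \<open>p\<close>.
\<close>

lemma mem_if_lgcd_le_plog:
  assumes H: "H \<in> nontrivial_subgroups" and x: "x \<noteq> 0" "\<And>p. lgcd H p \<le> bot.Value (plog x p)"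
  shows "x \<in> H"
proof -
  note sub = nontrivial_subgroupD(1)[OF H]
  define I where "I = {n. of_int n * x \<in> H}"
  have "1 \<in> I"
  proof (rule one_mem_int_ideal)
    show "m + n \<in> I" if "m \<in> I" "n \<in> I" for m n
      using sub that by (simp add: I_def subgroup_rational_group_iff algebra_simps)
    show "k * n \<in> I" if "n \<in> I" for k n
      using of_int_mult_closed[OF sub, of "of_int n * x" k] that by (simp add: I_def mult.assoc)
    show "\<exists>n\<in>I. \<not> int (nat_of_prime p) dvd n" for p
    proof -
      \<comment> \<open>The shift by 1 expresses over the integers that some valuation in H is at
        most that of x; the argument also covers the value \<open>Bot\<close>.\<close>
      have "\<not> bot.Value (plog x p + 1) \<le> lgcd H p"
        using x(2)[of p] by (cases "lgcd H p") auto
      then obtain h where h: "h \<in> H" "h \<noteq> 0" "\<not> plog x p + 1 \<le> plog h p"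
        unfolding lgcd_characterization[OF H] less_eq_bot_Value by blast
      have "h / x \<noteq> 0" using h x by simp
      then obtain a b where ab: "quotient_of (h / x) = (a, b)" "h / x = of_int a / of_int b"
        "a \<noteq> 0" "b > 0"
        by (rule quotient_of_nonzero)
      have "of_int a * x = of_int b * h" using ab x by (simp add: field_simps)
      then have "a \<in> I" using of_int_mult_closed[OF sub h(1), of b] by (simp add: I_def)
      moreover have "plog (h / x) p \<le> 0"
        using h x by (simp add: divide_inverse plog_mult plog_inverse)
      ultimately show ?thesis using plog_nonpos_imp_not_dvd ab by blast
    qed
  qed
  then show ?thesis by (simp add: I_def)
qed

lemma subgroup_of_seq_lgcd:
  assumes "H \<in> nontrivial_subgroups"
  shows "subgroup_of_seq (lgcd H) = H"
proof -
  have "0 \<in> H" using nontrivial_subgroupD(1)[OF assms] by (simp add: subgroup_rational_group_iff)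
  then have "x = 0 \<or> (\<forall>p. lgcd H p \<le> bot.Value (plog x p)) \<longleftrightarrow> x \<in> H" for x
    using mem_if_lgcd_le_plog[OF assms, of x] lgcd_le_plog[OF assms, of x] by auto
  then show ?thesis by (simp add: subgroup_of_seq_eq)
qed

text \<open>Each direction is the antitonicity of one of the two maps, the converse one after
  applying \<open>subgroup_of_seq\<close> to recover H and K.\<close>

lemma subset_iff_lgcd_le:
  assumes "H \<in> nontrivial_subgroups" "K \<in> nontrivial_subgroups"
  shows "H \<subseteq> K \<longleftrightarrow> lgcd K \<le> lgcd H"
  using assms lgcd_antimono subgroup_of_seq_antimono subgroup_of_seq_lgcd by metis

section \<open>The lattice structures\<close>

text \<open>Suprema and infima are required in the form of universal properties, which an
  order-reversing bijection transports directly; reflexivity turns them back into bounds.\<close>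

lemma lattice_gorderI:
  assumes "\<And>x. x \<in> A \<Longrightarrow> R x x"
    and "\<And>x y. x \<in> A \<Longrightarrow> y \<in> A \<Longrightarrow> R x y \<Longrightarrow> R y x \<Longrightarrow> x = y"
    and "\<And>x y z. x \<in> A \<Longrightarrow> y \<in> A \<Longrightarrow> z \<in> A \<Longrightarrow> R x y \<Longrightarrow> R y z \<Longrightarrow> R x z"
    and "\<And>x y. x \<in> A \<Longrightarrow> y \<in> A \<Longrightarrow> \<exists>s\<in>A. \<forall>z\<in>A. R s z \<longleftrightarrow> R x z \<and> R y z"
    and "\<And>x y. x \<in> A \<Longrightarrow> y \<in> A \<Longrightarrow> \<exists>s\<in>A. \<forall>z\<in>A. R z s \<longleftrightarrow> R z x \<and> R z y"
  shows "lattice \<lparr>carrier = A, eq = (=), le = R\<rparr>"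
proof (unfold_locales, goal_cases)
  case (9 x y)
  then obtain s where "s \<in> A" "\<forall>z\<in>A. R s z \<longleftrightarrow> R x z \<and> R y z"
    using assms(4)[of x y] by auto
  then show ?case
    using 9 assms(1) by (intro exI[of _ s]) (auto simp: least_def Upper_def)
next
  case (10 x y)
  then obtain s where "s \<in> A" "\<forall>z\<in>A. R z s \<longleftrightarrow> R z x \<and> R z y"
    using assms(5)[of x y] by auto
  then show ?case
    using 10 assms(1) by (intro exI[of _ s]) (auto simp: greatest_def Lower_def)
qed (auto intro: assms(1,2), metis assms(3))

lemma Seq_le_0_max:
  assumes "s \<in> Seq_le_0" "t \<in> Seq_le_0"
  shows "(\<lambda>p. max (s p) (t p)) \<in> Seq_le_0"
proof -
  have "{p. bot.Value 0 < max (s p) (t p)} = {p. bot.Value 0 < s p} \<union> {p. bot.Value 0 < t p}"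
    by (auto simp: less_max_iff_disj)
  with assms show ?thesis by (simp add: Seq_le_0_def)
qed

lemma Seq_le_0_min:
  assumes "s \<in> Seq_le_0"
  shows "(\<lambda>p. min (s p) (t p)) \<in> Seq_le_0"
  using assms unfolding Seq_le_0_def by (auto elim: rev_finite_subset)

lemma max_le_fun_iff: "(\<lambda>p. max (s p) (t p)) \<le> u \<longleftrightarrow> s \<le> u \<and> t \<le> u"
  for s t u :: "'a \<Rightarrow> 'b::linorder"
  unfolding le_fun_def by auto

lemma le_min_fun_iff: "u \<le> (\<lambda>p. min (s p) (t p)) \<longleftrightarrow> u \<le> s \<and> u \<le> t"
  for s t u :: "'a \<Rightarrow> 'b::linorder"
  unfolding le_fun_def by auto

lemma lattice_seq_lattice: "lattice seq_lattice"
  unfolding seq_lattice_def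
proof (rule lattice_gorderI)
  fix s t assume st: "s \<in> Seq_le_0" "t \<in> Seq_le_0"
  show "\<exists>u\<in>Seq_le_0. \<forall>z\<in>Seq_le_0. u \<le> z \<longleftrightarrow> s \<le> z \<and> t \<le> z"
    by (rule bexI[OF _ Seq_le_0_max[OF st]]) (simp add: max_le_fun_iff)
  show "\<exists>u\<in>Seq_le_0. \<forall>z\<in>Seq_le_0. z \<le> u \<longleftrightarrow> z \<le> s \<and> z \<le> t"
    by (rule bexI[OF _ Seq_le_0_min[OF st(1), of t]]) (simp add: le_min_fun_iff)
qed auto

lemma lattice_subgroup_lattice: "lattice subgroup_lattice"
  unfolding subgroup_lattice_def
proof (rule lattice_gorderI)
  fix H K assume HK: "H \<in> nontrivial_subgroups" "K \<in> nontrivial_subgroups"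
  note iso = subset_iff_lgcd_le lgcd_subgroup_of_seq
  \<comment> \<open>Because the correspondence reverses order, the join of two subgroups comes from
    the minimum of their sequences, and below the meet comes from the maximum. Sums and
    intersections of subgroups need not be computed.\<close>
  have s: "(\<lambda>p. min (lgcd H p) (lgcd K p)) \<in> Seq_le_0"
    using HK by (intro Seq_le_0_min lgcd_in_Seq_le_0)
  then show "\<exists>S\<in>nontrivial_subgroups. \<forall>Z\<in>nontrivial_subgroups. S \<subseteq> Z \<longleftrightarrow> H \<subseteq> Z \<and> K \<subseteq> Z"
    using HK subgroup_of_seq_nontrivial[OF s]
    by (intro bexI[OF _ subgroup_of_seq_nontrivial[OF s]]) (simp add: iso le_min_fun_iff)
  have t: "(\<lambda>p. max (lgcd H p) (lgcd K p)) \<in> Seq_le_0"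
    using HK by (intro Seq_le_0_max lgcd_in_Seq_le_0)
  then show "\<exists>S\<in>nontrivial_subgroups. \<forall>Z\<in>nontrivial_subgroups. Z \<subseteq> S \<longleftrightarrow> Z \<subseteq> H \<and> Z \<subseteq> K"
    using HK subgroup_of_seq_nontrivial[OF t]
    by (intro bexI[OF _ subgroup_of_seq_nontrivial[OF t]]) (simp add: iso max_le_fun_iff)
qed (rule order_refl subset_antisym subset_trans; assumption)+

theorem theorem3p2:
  shows "bij_betw lgcd nontrivial_subgroups Seq_le_0 \<and>
    (\<forall>s \<in> Seq_le_0. subgroup_of_seq s \<in> nontrivial_subgroups \<and> lgcd (subgroup_of_seq s) = s) \<and>
    (\<forall>H \<in> nontrivial_subgroups. subgroup_of_seq (lgcd H) = H) \<and>
    lattice subgroup_lattice \<and> lattice seq_lattice \<and>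
    (\<forall>H \<in> nontrivial_subgroups. \<forall>K \<in> nontrivial_subgroups.
        H \<subseteq> K \<longleftrightarrow> lgcd K \<le> lgcd H)"
proof -
  have "bij_betw lgcd nontrivial_subgroups Seq_le_0"
    by (rule bij_betw_byWitness[where f' = subgroup_of_seq])
      (auto simp: subgroup_of_seq_lgcd lgcd_subgroup_of_seq lgcd_in_Seq_le_0 subgroup_of_seq_nontrivial)
  then show ?thesis
    by (simp add: subgroup_of_seq_lgcd lgcd_subgroup_of_seq subgroup_of_seq_nontrivial
        lattice_subgroup_lattice lattice_seq_lattice subset_iff_lgcd_le)
qed

end
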